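(* Let $\mathbb F_q$ be a finite field with $q$ elements, let $n\ge 2$, let $a_1,\dots,a_n,b\in\mathbb F_q^*$ and let $k,k_1,\dots,k_n,m_1,\dots,m_n$ be positive integers. Let $N_q$ be the number of solutions $(x_1,\dots,x_n)\in\mathbb F_q^n$ of $$(a_1x_1^{m_1}+\dots+a_nx_n^{m_n})^k=bx_1^{k_1}\cdots x_n^{k_n}.$$ Let $d_j=\gcd(m_j,q-1)$ and $k_0=\gcd(k,k_1,\dots,k_n,q-1)$. Assume that for some $0\le t\le n$, $d_1,\dots,d_t$ are odd, $d_{t+1},\dots,d_n$ are even, and the numbers $d_1,\dots,d_t,d_{t+1}/2,\dots,d_n/2$ are pairwise coprime; and assume that $b$ is not a $k_0$th power in $\mathbb F_q$. Then: if $t=0$ and $n$ is even, $$N_q=q^{n-1}-\frac{(q-1)^n+q-1}{q}-(q-1)\sum_{j=1}^{(n-2)/2}\eta((-1)^j)\sigma_{2j}(\eta(a_1),\dots,\eta(a_n))q^{j-1};$$ if $t=n$, $$N_q=q^{n-1}-\frac{(q-1)^n+(-1)^n(q-1)}{q};$$ otherwise $$N_q=q^{n-1}-\frac{(q-1)^n+(-1)^n(q-1)}{q}-(-1)^n(q-1)\sum_{j=1}^{[(n-t)/2]}\eta((-1)^j)\sigma_{2j}(\eta(a_{t+1}),\dots,\eta(a_n))q^{j-1}.$$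
   Context: For $q$ odd, $\eta$ is the quadratic character of $\mathbb F_q$: $\eta(x)=1,-1,0$ according as $x$ is a nonzero square, a nonsquare, or $0$ (in the cases where $\eta$ appears, some $d_j$ is even, so $q$ is odd). $\sigma_{2j}(z_1,\dots,z_r)$ denotes the elementary symmetric polynomial of degree $2j$ in $z_1,\dots,z_r$. $[x]$ denotes the integer part; empty sums are $0$. *)

theory Defs
  imports Complex_Main "HOL-Library.FuncSet"
begin

definition qchar :: "'a::{field,finite} \<Rightarrow> int" where
  "qchar x = (if x = 0 then 0 else if (\<exists>y. y ^ 2 = x) then 1 else -1)"

definition esym :: "nat set \<Rightarrow> (nat \<Rightarrow> real) \<Rightarrow> nat \<Rightarrow> real" where
  "esym S z r = (\<Sum>T \<in> {T. T \<subseteq> S \<and> card T = r}. \<Prod>i\<in>T. z i)"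

end

theory Submission
  imports Defs
begin

text \<open>Since \<open>b\<close> is not a \<open>k\<^sub>0\<close>-th power, a solution has a vanishing coordinate, so \<open>N\<^sub>q\<close> is the
  number of all zeros of \<open>\<Sum> a\<^sub>i x\<^sub>i ^ m\<^sub>i\<close> minus the number of those without zero coordinate.
  By homogeneity, the latter number depends only on which \<open>y\<close> in the torus admit a \<open>\<mu>\<close> such that
  every \<open>\<mu> y\<^sub>i\<close> is an \<open>m\<^sub>i\<close>-th power. By the coprimality hypothesis this holds iff all
  \<open>y\<^sub>i\<close> with \<open>d\<^sub>i\<close> even have the same quadratic character, so \<open>m\<^sub>i\<close> may be replaced by 1 for
  \<open>i \<le> t\<close> and by 2 for \<open>i > t\<close>. Decomposing by supports, the same holds for the zeros in affine space.
  The remaining linear-quadratic counts are convolutions of the functions 1, \<open>\<delta>\<^sub>0\<close> and the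
  quadratic character, whose convolution square is \<open>\<eta>(-1) (q \<delta>\<^sub>0 - 1)\<close>.\<close>

section \<open>Reduction to exponents 1 and 2\<close>

lemma finite_field_power_card_minus_one:
  fixes x :: "'a::{field,finite}"
  assumes "x \<noteq> 0"
  shows "x ^ (card (UNIV :: 'a set) - 1) = 1"
proof -
  let ?U = "UNIV - {0 :: 'a}"
  have "(\<Prod>y\<in>?U. y) = (\<Prod>y\<in>?U. x * y)"
    by (rule prod.reindex_bij_witness[of _ "\<lambda>y. x * y" "\<lambda>y. y / x"]) (use assms in auto)
  also have "\<dots> = x ^ card ?U * (\<Prod>y\<in>?U. y)"
    by (simp add: prod.distrib)
  finally have "x ^ card ?U = 1"
    by simp
  thus ?thesis
    by (simp add: card_Diff_subset)
qed

text \<open>The Bezout coefficients of \<open>m\<close> and \<open>n\<close> serve as integer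
  exponents of \<open>x\<close>; one of them may be negative, hence \<open>powi\<close> and
  \<open>x \<noteq> 0\<close>. This takes the place of a discrete logarithm.\<close>

lemma bezout_power:
  fixes x :: "'a::field"
  assumes "x \<noteq> 0"
  obtains y z where "y \<noteq> 0" "z \<noteq> 0" "y ^ m * z ^ n = x ^ gcd m n"
proof -
  obtain u v where uv: "u * int m + v * int n = int (gcd m n)"
    using bezout_int[of "int m" "int n"] by auto
  have "(x powi u) ^ m * (x powi v) ^ n = x powi (u * int m + v * int n)"
    using assms by (simp add: power_int_add power_int_mult)
  also have "\<dots> = x ^ gcd m n"
    by (simp only: uv power_int_of_nat)
  finally show ?thesis
    using that[of "x powi u" "x powi v"] assms by auto
qed

text \<open>In the Bezout factorization for \<open>m\<close> and \<open>q - 1\<close>, the second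
  factor is a \<open>(q - 1)\<close>-th power, so it equals 1.\<close>

lemma power_gcd_card_minus_one_iff:
  fixes x :: "'a::{field,finite}"
  shows "(\<exists>z. z \<noteq> 0 \<and> z ^ m = x) \<longleftrightarrow> (\<exists>z. z \<noteq> 0 \<and> z ^ gcd m (card (UNIV :: 'a set) - 1) = x)"
    (is "?L \<longleftrightarrow> ?R")
proof
  assume ?L
  then obtain z where "z \<noteq> 0" "z ^ m = x" by auto
  moreover have "m = m div gcd m (card (UNIV :: 'a set) - 1) * gcd m (card (UNIV :: 'a set) - 1)"
    by simp
  ultimately show ?R
    by (metis power_mult power_not_zero)
next
  assume ?R
  then obtain z where z: "z \<noteq> 0" "z ^ gcd m (card (UNIV :: 'a set) - 1) = x" by auto
  obtain y w where "y \<noteq> 0" "w \<noteq> 0"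
    "y ^ m * w ^ (card (UNIV :: 'a set) - 1) = z ^ gcd m (card (UNIV :: 'a set) - 1)"
    using bezout_power[OF z(1)] by metis
  thus ?L
    using z finite_field_power_card_minus_one[of w] by (metis mult.right_neutral)
qed

text \<open>The Chinese remainder theorem for exponents, phrased without a generator of the unit group.\<close>

lemma common_multiplier_into_powers:
  fixes z :: "'i \<Rightarrow> 'a::field"
  assumes "finite I" "\<And>i. i \<in> I \<Longrightarrow> z i \<noteq> 0"
    and "\<And>i j. i \<in> I \<Longrightarrow> j \<in> I \<Longrightarrow> i \<noteq> j \<Longrightarrow> coprime (D i :: nat) (D j)"
  shows "\<exists>\<mu>. \<mu> \<noteq> 0 \<and> (\<forall>i\<in>I. \<exists>w. w \<noteq> 0 \<and> \<mu> * z i = w ^ D i)"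
  using assms
proof (induction I rule: finite_induct)
  case empty
  show ?case by (auto intro: exI[of _ 1])
next
  case (insert j I)
  obtain \<mu> where \<mu>: "\<mu> \<noteq> 0" "\<And>i. i \<in> I \<Longrightarrow> \<exists>w. w \<noteq> 0 \<and> \<mu> * z i = w ^ D i"
    using insert.IH insert.prems by auto
  let ?P = "\<Prod>i\<in>I. D i"
  have "coprime ?P (D j)"
    using insert by (intro prod_coprime_left) auto
  moreover have nz: "\<mu> * z j \<noteq> 0"
    using \<mu> insert.prems by auto
  ultimately obtain u v where uv: "u \<noteq> 0" "v \<noteq> 0" "u ^ ?P * v ^ D j = \<mu> * z j"
    by (metis bezout_power[OF nz, of ?P "D j"] coprime_imp_gcd_eq_1 power_one_right)
  \<comment> \<open>Dividing \<mu> by \<open>u ^ ?P\<close> turns the new coordinate into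
    \<open>v ^ D j\<close>. The old coordinates stay powers because each \<open>D i\<close> divides
    \<open>?P\<close>.\<close>
  show ?case
  proof (rule exI[of _ "\<mu> / u ^ ?P"], intro conjI ballI)
    fix i assume i: "i \<in> insert j I"
    show "\<exists>w. w \<noteq> 0 \<and> \<mu> / u ^ ?P * z i = w ^ D i"
    proof (cases "i = j")
      case True
      thus ?thesis
        using uv by (intro exI[of _ v]) (simp flip: uv(3))
    next
      case False
      with i have "i \<in> I" by auto
      then obtain w where w: "w \<noteq> 0" "\<mu> * z i = w ^ D i" using \<mu> by blast
      have "?P = (\<Prod>k\<in>I - {i}. D k) * D i"
        using \<open>i \<in> I\<close> insert.hyps by (simp add: prod.remove mult.commute)
      hence "u ^ ?P = (u ^ (\<Prod>k\<in>I - {i}. D k)) ^ D i"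
        by (simp add: power_mult)
      hence "\<mu> / u ^ ?P * z i = (w / u ^ (\<Prod>k\<in>I - {i}. D k)) ^ D i"
        using w by (simp add: power_divide)
      thus ?thesis
        using w uv by (intro exI[of _ "w / u ^ (\<Prod>k\<in>I - {i}. D k)"]) simp
    qed
  next
    show "\<mu> / u ^ ?P \<noteq> 0" using \<mu>(1) uv(1) by simp
  qed
qed

text \<open>Each fibre has \<open>card A / card (f ` A)\<close> points, so equal images force equal fibre sizes.\<close>

lemma card_preimage_eq_of_equal_images:
  assumes A: "finite A" and img: "f ` A = g ` A"
    and f: "\<And>y. y \<in> f ` A \<Longrightarrow> card {p \<in> A. f p = y} = c"
    and g: "\<And>y. y \<in> g ` A \<Longrightarrow> card {p \<in> A. g p = y} = c'"
  shows "card {p \<in> A. P (f p)} = card {p \<in> A. P (g p)}"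
proof -
  have *: "card {p \<in> A. P (h p)} = r * card {y \<in> h ` A. P y}"
    if h: "\<And>y. y \<in> h ` A \<Longrightarrow> card {p \<in> A. h p = y} = r" for h :: "'a \<Rightarrow> 'b" and r P
  proof -
    have "(\<Sum>y\<in>{y \<in> h ` A. P y}. \<Sum>p\<in>{p \<in> {p \<in> A. P (h p)}. h p = y}. 1) =
          (\<Sum>p\<in>{p \<in> A. P (h p)}. 1 :: nat)"
      using A by (intro sum.group) auto
    hence "card {p \<in> A. P (h p)} = (\<Sum>y\<in>{y \<in> h ` A. P y}. card {p \<in> {p \<in> A. P (h p)}. h p = y})"
      by simp
    also have "\<dots> = (\<Sum>y\<in>{y \<in> h ` A. P y}. card {p \<in> A. h p = y})"
      by (rule sum.cong) (auto intro!: arg_cong[of _ _ card])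
    also have "\<dots> = r * card {y \<in> h ` A. P y}"
      using h by simp
    finally show ?thesis .
  qed
  \<comment> \<open>With the trivial predicate both sides count all of \<open>A\<close>, which
    forces \<open>c = c'\<close> unless \<open>A\<close> is empty.\<close>
  have "c * card (f ` A) = c' * card (f ` A)"
    using *[of f c "\<lambda>_. True"] *[of g c' "\<lambda>_. True"] f g img by simp
  hence "c = c' \<or> A = {}"
    using A by auto
  thus ?thesis
    using *[of f c P] *[of g c' P] f g img by auto
qed

text \<open>Here the coprimality hypothesis enters. The free factor \<mu> absorbs everything about
  the exponents except the parity of the \<open>d (m i)\<close>, which decides whether the twisted
  coordinate must be a square.\<close>

lemma twisted_power_image_iff:
  fixes y :: "nat \<Rightarrow> 'a::{field,finite}"
  defines "d \<equiv> (\<lambda>m. gcd m (card (UNIV :: 'a set) - 1))"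
  assumes "finite I" "\<And>i. i \<in> I \<Longrightarrow> y i \<noteq> 0"
    and odd_d: "\<And>i. i \<in> I - J \<Longrightarrow> odd (d (m i))"
    and even_d: "\<And>i. i \<in> I \<inter> J \<Longrightarrow> even (d (m i))"
    and copr: "\<And>i j. i \<in> I \<Longrightarrow> j \<in> I \<Longrightarrow> i \<noteq> j \<Longrightarrow>
      coprime (if i \<in> J then d (m i) div 2 else d (m i)) (if j \<in> J then d (m j) div 2 else d (m j))"
  shows "(\<exists>\<mu>. \<mu> \<noteq> 0 \<and> (\<forall>i\<in>I. \<exists>z. z \<noteq> 0 \<and> z ^ m i = \<mu> * y i)) \<longleftrightarrow>
         (\<exists>\<mu>. \<mu> \<noteq> 0 \<and> (\<forall>i\<in>I. \<exists>z. z \<noteq> 0 \<and> z ^ (if i \<in> J then 2 else 1) = \<mu> * y i))"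
    (is "?L \<longleftrightarrow> ?R")
proof
  assume ?L
  then obtain \<mu> where \<mu>: "\<mu> \<noteq> 0" "\<And>i. i \<in> I \<Longrightarrow> \<exists>z. z \<noteq> 0 \<and> z ^ m i = \<mu> * y i"
    by blast
  have "\<exists>z. z \<noteq> 0 \<and> z ^ (if i \<in> J then 2 else 1) = \<mu> * y i" if i: "i \<in> I" for i
  proof (cases "i \<in> J")
    case True
    have "d (m i) dvd m i"
      by (simp add: d_def)
    hence "even (m i)"
      using even_d[of i] True i by (meson IntI dvd_trans)
    moreover obtain z where z: "z \<noteq> 0" "z ^ m i = \<mu> * y i"
      using \<mu>(2)[OF i] by blast
    ultimately have "(z ^ (m i div 2)) ^ 2 = \<mu> * y i"
      by (simp flip: power_mult)
    thus ?thesis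
      using True z(1) by (intro exI[of _ "z ^ (m i div 2)"]) simp
  next
    case False
    thus ?thesis
      using \<mu>(1) i assms(3) by (intro exI[of _ "\<mu> * y i"]) simp
  qed
  thus ?R
    using \<mu>(1) by blast
next
  assume ?R
  then obtain \<mu> where \<mu>: "\<mu> \<noteq> 0"
    "\<And>i. i \<in> I \<Longrightarrow> \<exists>z. z \<noteq> 0 \<and> z ^ (if i \<in> J then 2 else 1) = \<mu> * y i"
    by blast
  \<comment> \<open>Up to a \<open>d i\<close>-th power, every \<open>\<mu> y\<^sub>i\<close> is a square: for odd \<open>d\<close>,
      \<open>u = (u ^ ((d + 1) div 2)) ^ 2 / u ^ d\<close>. Multiplying \<open>\<mu>\<close> by a further square
      then only requires simultaneous powers with pairwise coprime exponents.\<close>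
  have "\<exists>s v. s \<noteq> 0 \<and> v \<noteq> 0 \<and> \<mu> * y i = s ^ 2 * v ^ d (m i)" if i: "i \<in> I" for i
  proof (cases "i \<in> J")
    case True
    obtain s where s: "s \<noteq> 0" "s ^ 2 = \<mu> * y i"
      using \<mu>(2)[OF i] True by auto
    thus ?thesis
      by (intro exI[of _ s] exI[of _ 1]) simp
  next
    case False
    define u where "u = \<mu> * y i"
    have u: "u \<noteq> 0" using \<mu>(1) i assms(3) by (simp add: u_def)
    obtain r where r: "d (m i) = 2 * r + 1"
      using odd_d[of i] False i by (auto elim: oddE)
    have "(u ^ (r + 1)) ^ 2 = u * u ^ d (m i)"
      by (simp add: r power_mult mult_ac power2_eq_square flip: power_add)
    hence "u = (u ^ (r + 1)) ^ 2 * inverse u ^ d (m i)"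
      using u by (simp add: power_inverse)
    thus ?thesis
      using u unfolding u_def[symmetric]
      by (intro exI[of _ "u ^ (r + 1)"] exI[of _ "inverse u"]) simp
  qed
  then obtain s v where sv: "\<And>i. i \<in> I \<Longrightarrow> s i \<noteq> 0 \<and> v i \<noteq> 0 \<and> \<mu> * y i = s i ^ 2 * v i ^ d (m i)"
    by metis
  have "\<exists>\<nu>. \<nu> \<noteq> 0 \<and> (\<forall>i\<in>I. \<exists>w. w \<noteq> 0 \<and>
      \<nu> * s i = w ^ (if i \<in> J then d (m i) div 2 else d (m i)))"
    by (rule common_multiplier_into_powers[OF \<open>finite I\<close> _ copr]) (simp_all add: sv)
  then obtain \<nu> where \<nu>: "\<nu> \<noteq> 0"
    "\<And>i. i \<in> I \<Longrightarrow> \<exists>w. w \<noteq> 0 \<and> \<nu> * s i = w ^ (if i \<in> J then d (m i) div 2 else d (m i))"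
    by blast
  have "\<exists>z. z \<noteq> 0 \<and> z ^ m i = \<nu> ^ 2 * \<mu> * y i" if i: "i \<in> I" for i
  proof -
    obtain w where w: "w \<noteq> 0" "\<nu> * s i = w ^ (if i \<in> J then d (m i) div 2 else d (m i))"
      using \<nu>(2)[OF i] by blast
    \<comment> \<open>Squaring doubles the exponent: on \<open>J\<close> it lifts
      \<open>d (m i) div 2\<close> to \<open>d (m i)\<close>, which is why coprimality of the halves
      suffices there.\<close>
    have "\<exists>z. z \<noteq> 0 \<and> z ^ d (m i) = (\<nu> * s i) ^ 2"
    proof (cases "i \<in> J")
      case True
      hence "d (m i) div 2 * 2 = d (m i)" using even_d[of i] i by simp
      thus ?thesis
        using w True by (intro exI[of _ w]) (simp flip: power_mult)
    next
      case False
      thus ?thesis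
        using w by (intro exI[of _ "w ^ 2"]) (simp add: mult.commute flip: power_mult)
    qed
    then obtain z where z: "z \<noteq> 0" "z ^ d (m i) = (\<nu> * s i) ^ 2" by blast
    have "(z * v i) ^ d (m i) = \<nu> ^ 2 * (s i ^ 2 * v i ^ d (m i))"
      by (simp add: power_mult_distrib z(2) mult_ac)
    also have "\<dots> = \<nu> ^ 2 * \<mu> * y i"
      using sv[OF i] by (simp add: mult.assoc)
    finally have "(z * v i) ^ d (m i) = \<nu> ^ 2 * \<mu> * y i" .
    moreover have "z * v i \<noteq> 0"
      using z(1) sv[OF i] by simp
    ultimately show ?thesis
      using power_gcd_card_minus_one_iff[of "m i" "\<nu> ^ 2 * \<mu> * y i"] unfolding d_def by blast
  qed
  thus ?L
    using \<mu>(1) \<nu>(1) by (intro exI[of _ "\<nu> ^ 2 * \<mu>"]) simp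
qed

text \<open>Homogeneity: the solution set is stable under a scaling of the monomials, so it may be counted on
  the fibres of the homomorphism \<open>(\<mu>, x) \<mapsto> (x\<^sub>i ^ m\<^sub>i / \<mu>)\<^sub>i\<close>, which depend on the exponents
  only through their common size and the image.\<close>

lemma card_torus_diagonal_eq:
  fixes a :: "nat \<Rightarrow> 'a::{field,finite}"
  assumes "finite I"
    and img: "\<And>y :: nat \<Rightarrow> 'a. (\<And>i. i \<in> I \<Longrightarrow> y i \<noteq> 0) \<Longrightarrow>
      (\<exists>\<mu>. \<mu> \<noteq> 0 \<and> (\<forall>i\<in>I. \<exists>z. z \<noteq> 0 \<and> z ^ m i = \<mu> * y i)) \<longleftrightarrow>
      (\<exists>\<mu>. \<mu> \<noteq> 0 \<and> (\<forall>i\<in>I. \<exists>z. z \<noteq> 0 \<and> z ^ e i = \<mu> * y i))"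
  shows "card {x \<in> I \<rightarrow>\<^sub>E (UNIV - {0}). (\<Sum>i\<in>I. a i * x i ^ m i) = 0} =
         card {x \<in> I \<rightarrow>\<^sub>E (UNIV - {0}). (\<Sum>i\<in>I. a i * x i ^ e i) = 0}"
proof -
  define U where "U = UNIV - {0 :: 'a}"
  define X where "X = (I \<rightarrow>\<^sub>E U)"
  define \<phi> where "\<phi> = (\<lambda>m :: nat \<Rightarrow> nat. \<lambda>(\<mu>, x). \<lambda>i\<in>I. x i ^ m i / \<mu> :: 'a)"
  have finU: "finite U" and finX: "finite X"
    using \<open>finite I\<close> by (auto simp: U_def X_def intro: finite_PiE)
  have image_iff: "y \<in> \<phi> m ` (U \<times> X) \<longleftrightarrow>
    y \<in> X \<and> (\<exists>\<mu>. \<mu> \<noteq> 0 \<and> (\<forall>i\<in>I. \<exists>z. z \<noteq> 0 \<and> z ^ m i = \<mu> * y i))" for m y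
  proof
    assume "y \<in> \<phi> m ` (U \<times> X)"
    then obtain \<mu> x where *: "\<mu> \<in> U" "x \<in> X" "y = (\<lambda>i\<in>I. x i ^ m i / \<mu>)"
      by (auto simp: \<phi>_def)
    have "y \<in> X"
      using * by (auto simp: X_def U_def PiE_iff)
    moreover have "\<forall>i\<in>I. \<exists>z. z \<noteq> 0 \<and> z ^ m i = \<mu> * y i"
      using * by (auto simp: X_def U_def PiE_iff)
    ultimately show "y \<in> X \<and> (\<exists>\<mu>. \<mu> \<noteq> 0 \<and> (\<forall>i\<in>I. \<exists>z. z \<noteq> 0 \<and> z ^ m i = \<mu> * y i))"
      using *(1) by (auto simp: U_def)
  next
    assume R: "y \<in> X \<and> (\<exists>\<mu>. \<mu> \<noteq> 0 \<and> (\<forall>i\<in>I. \<exists>z. z \<noteq> 0 \<and> z ^ m i = \<mu> * y i))"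
    then obtain \<mu> z where z: "\<mu> \<noteq> 0" "\<And>i. i \<in> I \<Longrightarrow> z i \<noteq> 0 \<and> z i ^ m i = \<mu> * y i"
      by metis
    have "y = \<phi> m (\<mu>, restrict z I)"
      using R z by (intro ext) (auto simp: \<phi>_def X_def PiE_iff extensional_def)
    moreover have "(\<mu>, restrict z I) \<in> U \<times> X"
      using z by (auto simp: U_def X_def)
    ultimately show "y \<in> \<phi> m ` (U \<times> X)"
      by blast
  qed
  \<comment> \<open>Since \<open>\<phi> m\<close> is multiplicative, division by one point of a
    nonempty fibre maps that fibre bijectively onto the kernel. The kernel size may depend on the
    exponents.\<close>
  have fibre: "card {p \<in> U \<times> X. \<phi> m p = y} = card {p \<in> U \<times> X. \<phi> m p = (\<lambda>i\<in>I. 1)}"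
    if y: "y \<in> \<phi> m ` (U \<times> X)" for m y
  proof -
    obtain \<mu> w where w: "\<mu> \<in> U" "w \<in> X" "y = \<phi> m (\<mu>, w)"
      using y by auto
    show ?thesis
    proof (rule bij_betw_same_card, rule bij_betwI)
      show "(\<lambda>(\<kappa>, x). (\<kappa> / \<mu>, \<lambda>i\<in>I. x i / w i)) \<in>
              {p \<in> U \<times> X. \<phi> m p = y} \<rightarrow> {p \<in> U \<times> X. \<phi> m p = (\<lambda>i\<in>I. 1)}"
        using w by (auto simp: \<phi>_def U_def X_def PiE_iff power_divide frac_eq_eq fun_eq_iff restrict_def split: if_splits)
      show "(\<lambda>(\<kappa>, x). (\<kappa> * \<mu>, \<lambda>i\<in>I. x i * w i)) \<in>
              {p \<in> U \<times> X. \<phi> m p = (\<lambda>i\<in>I. 1)} \<rightarrow> {p \<in> U \<times> X. \<phi> m p = y}"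
        using w by (auto simp: \<phi>_def U_def X_def PiE_iff power_mult_distrib fun_eq_iff restrict_def split: if_splits)
      have cancel: "(\<lambda>i\<in>I. (\<lambda>i\<in>I. x i / w i) i * w i) = x" "(\<lambda>i\<in>I. (\<lambda>i\<in>I. x i * w i) i / w i) = x"
        if "x \<in> X" for x
        using w(2) that by (auto simp: X_def U_def PiE_iff extensional_def)
      show "(\<lambda>(\<kappa>, x). (\<kappa> * \<mu>, \<lambda>i\<in>I. x i * w i)) ((\<lambda>(\<kappa>, x). (\<kappa> / \<mu>, \<lambda>i\<in>I. x i / w i)) p) = p"
        if "p \<in> {p \<in> U \<times> X. \<phi> m p = y}" for p
        using that w(1) cancel by (cases p) (simp add: U_def del: restrict_apply)
      show "(\<lambda>(\<kappa>, x). (\<kappa> / \<mu>, \<lambda>i\<in>I. x i / w i)) ((\<lambda>(\<kappa>, x). (\<kappa> * \<mu>, \<lambda>i\<in>I. x i * w i)) p) = p"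
        if "p \<in> {p \<in> U \<times> X. \<phi> m p = (\<lambda>i\<in>I. 1)}" for p
        using that w(1) cancel by (cases p) (simp add: U_def del: restrict_apply)
    qed
  qed
  define P where "P = (\<lambda>y. (\<Sum>i\<in>I. a i * y i) = 0)"
  \<comment> \<open>The factor \<open>1 / \<mu>\<close> comes out of the linear form, so
    \<open>P\<close> ignores \<mu> and every solution \<open>x\<close> is counted
    \<open>card U\<close> times.\<close>
  have count: "card {p \<in> U \<times> X. P (\<phi> m p)} = card U * card {x \<in> X. (\<Sum>i\<in>I. a i * x i ^ m i) = 0}" for m
  proof -
    have "P (\<phi> m (\<mu>, x)) \<longleftrightarrow> (\<Sum>i\<in>I. a i * x i ^ m i) = 0" if "\<mu> \<in> U" for \<mu> x
    proof -
      have "(\<Sum>i\<in>I. a i * \<phi> m (\<mu>, x) i) = (\<Sum>i\<in>I. a i * x i ^ m i) / \<mu>"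
        by (simp add: \<phi>_def sum_divide_distrib)
      thus ?thesis
        using that by (simp add: P_def U_def)
    qed
    hence "{p \<in> U \<times> X. P (\<phi> m p)} = U \<times> {x \<in> X. (\<Sum>i\<in>I. a i * x i ^ m i) = 0}"
      by auto
    thus ?thesis
      by (simp add: card_cartesian_product)
  qed
  have "\<phi> m ` (U \<times> X) = \<phi> e ` (U \<times> X)"
  proof (intro set_eqI)
    fix y
    show "y \<in> \<phi> m ` (U \<times> X) \<longleftrightarrow> y \<in> \<phi> e ` (U \<times> X)"
      unfolding image_iff using img[of y] by (auto simp: X_def U_def PiE_iff)
  qed
  hence "card {p \<in> U \<times> X. P (\<phi> m p)} = card {p \<in> U \<times> X. P (\<phi> e p)}"
    using finU finX by (intro card_preimage_eq_of_equal_images[OF _ _ fibre fibre]) auto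
  moreover have "1 \<in> U"
    by (simp add: U_def)
  hence "card U \<noteq> 0"
    using finU by auto
  ultimately show ?thesis
    unfolding count by (simp add: X_def U_def)
qed

text \<open>A point is determined by its support and its nonzero coordinates. The index set is an
  argument of \<open>P\<close> so that the hypothesis can say that zero coordinates do not affect
  the condition.\<close>

lemma card_PiE_by_support:
  fixes P :: "nat set \<Rightarrow> (nat \<Rightarrow> 'a::{zero,finite}) \<Rightarrow> bool"
  assumes "finite I"
    and P: "\<And>x. P I x \<longleftrightarrow> P {i \<in> I. x i \<noteq> 0} (restrict x {i \<in> I. x i \<noteq> 0})"
  shows "card {x \<in> I \<rightarrow>\<^sub>E UNIV. P I x} =
         (\<Sum>S\<in>Pow I. card {x \<in> S \<rightarrow>\<^sub>E (UNIV - {0}). P S x})"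
proof -
  let ?supp = "\<lambda>x. {i \<in> I. x i \<noteq> 0}"
  have fin: "finite {x \<in> I \<rightarrow>\<^sub>E (UNIV :: 'a set). P I x}"
    using finite_PiE[OF \<open>finite I\<close>, of "\<lambda>_. UNIV :: 'a set"] by simp
  have "(\<Sum>S\<in>Pow I. \<Sum>x\<in>{x \<in> {x \<in> I \<rightarrow>\<^sub>E (UNIV :: 'a set). P I x}. ?supp x = S}. 1) =
          (\<Sum>x\<in>{x \<in> I \<rightarrow>\<^sub>E (UNIV :: 'a set). P I x}. 1 :: nat)"
    by (rule sum.group) (use fin \<open>finite I\<close> in auto)
  hence "card {x \<in> I \<rightarrow>\<^sub>E (UNIV :: 'a set). P I x} =
      (\<Sum>S\<in>Pow I. card {x \<in> {x \<in> I \<rightarrow>\<^sub>E (UNIV :: 'a set). P I x}. ?supp x = S})"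
    by simp
  also have "\<dots> = (\<Sum>S\<in>Pow I. card {x \<in> S \<rightarrow>\<^sub>E (UNIV - {0}). P S x})"
  proof (rule sum.cong[OF refl])
    fix S assume S: "S \<in> Pow I"
    \<comment> \<open>Extension by 0 on \<open>I - S\<close>; outside \<open>I\<close> the value
      stays \<open>undefined\<close>, as membership in the extensional function space
      demands.\<close>
    let ?ext = "\<lambda>x. \<lambda>i\<in>I. if i \<in> S then x i else 0"
    have supp_ext: "?supp (?ext x) = S \<and> restrict (?ext x) S = x" if "x \<in> S \<rightarrow>\<^sub>E (UNIV - {0})" for x
      using S that by (auto simp: PiE_iff extensional_def fun_eq_iff)
    show "card {x \<in> {x \<in> I \<rightarrow>\<^sub>E (UNIV :: 'a set). P I x}. ?supp x = S} =
          card {x \<in> S \<rightarrow>\<^sub>E (UNIV - {0}). P S x}"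
    proof (rule bij_betw_same_card, rule bij_betwI)
      show "(\<lambda>x. restrict x S) \<in> {x \<in> {x \<in> I \<rightarrow>\<^sub>E (UNIV :: 'a set). P I x}. ?supp x = S} \<rightarrow>
              {x \<in> S \<rightarrow>\<^sub>E (UNIV - {0}). P S x}"
        using P by (auto simp: PiE_iff)
      show "?ext \<in> {x \<in> S \<rightarrow>\<^sub>E (UNIV - {0}). P S x} \<rightarrow>
              {x \<in> {x \<in> I \<rightarrow>\<^sub>E (UNIV :: 'a set). P I x}. ?supp x = S}"
      proof
        fix x assume x: "x \<in> {x \<in> S \<rightarrow>\<^sub>E (UNIV - {0}). P S x}"
        hence "?supp (?ext x) = S" "restrict (?ext x) S = x"
          using supp_ext[of x] by blast+
        moreover from this have "P I (?ext x)"
          using P[of "?ext x"] x by simp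
        ultimately show "?ext x \<in> {x \<in> {x \<in> I \<rightarrow>\<^sub>E (UNIV :: 'a set). P I x}. ?supp x = S}"
          by (simp add: PiE_iff)
      qed
      show "?ext (restrict x S) = x"
        if "x \<in> {x \<in> {x \<in> I \<rightarrow>\<^sub>E (UNIV :: 'a set). P I x}. ?supp x = S}" for x
        using that S by (auto simp: PiE_iff extensional_def fun_eq_iff)
      show "restrict (?ext x) S = x" if "x \<in> {x \<in> S \<rightarrow>\<^sub>E (UNIV - {0}). P S x}" for x
        using that supp_ext[of x] by blast
    qed
  qed
  finally show ?thesis .
qed

text \<open>Affine space is the disjoint union of tori indexed by supports. Positive exponents
  ensure that a zero coordinate contributes 0, whereas \<open>0 ^ 0 = 1\<close> would not.\<close>

lemma card_affine_diagonal_eq: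
  fixes a :: "nat \<Rightarrow> 'a::{field,finite}"
  assumes "finite I" "\<And>i. i \<in> I \<Longrightarrow> m i > 0" "\<And>i. i \<in> I \<Longrightarrow> e i > 0"
    and eq: "\<And>S. S \<subseteq> I \<Longrightarrow> card {x \<in> S \<rightarrow>\<^sub>E (UNIV - {0}). (\<Sum>i\<in>S. a i * x i ^ m i) = 0} =
                   card {x \<in> S \<rightarrow>\<^sub>E (UNIV - {0}). (\<Sum>i\<in>S. a i * x i ^ e i) = 0}"
  shows "card {x \<in> I \<rightarrow>\<^sub>E UNIV. (\<Sum>i\<in>I. a i * x i ^ m i) = 0} =
         card {x \<in> I \<rightarrow>\<^sub>E UNIV. (\<Sum>i\<in>I. a i * x i ^ e i) = 0}"
proof -
  have *: "card {x \<in> I \<rightarrow>\<^sub>E UNIV. (\<Sum>i\<in>I. a i * x i ^ f i) = 0} =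
      (\<Sum>S\<in>Pow I. card {x \<in> S \<rightarrow>\<^sub>E (UNIV - {0}). (\<Sum>i\<in>S. a i * x i ^ f i) = 0})"
    if f: "\<And>i. i \<in> I \<Longrightarrow> f i > 0" for f
  proof (rule card_PiE_by_support[OF \<open>finite I\<close>])
    fix x :: "nat \<Rightarrow> 'a"
    have "(\<Sum>i\<in>I. a i * x i ^ f i) = (\<Sum>i\<in>{i \<in> I. x i \<noteq> 0}. a i * restrict x {i \<in> I. x i \<noteq> 0} i ^ f i)"
      using \<open>finite I\<close> by (intro sum.mono_neutral_cong_right) (auto simp: zero_power f)
    thus "(\<Sum>i\<in>I. a i * x i ^ f i) = 0 \<longleftrightarrow>
          (\<Sum>i\<in>{i \<in> I. x i \<noteq> 0}. a i * restrict x {i \<in> I. x i \<noteq> 0} i ^ f i) = 0"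
      by simp
  qed
  show ?thesis
    using *[of m] *[of e] assms by simp
qed

section \<open>Convolutions of the quadratic character\<close>

lemma card_square_roots:
  fixes y :: "'a::{field,finite}"
  assumes "(2 :: 'a) \<noteq> 0"
  shows "int (card {x. x ^ 2 = y}) = 1 + qchar y"
proof (cases "\<exists>x. x ^ 2 = y")
  case True
  then obtain x where x: "x ^ 2 = y" by blast
  hence *: "{z. z ^ 2 = y} = {x, - x}"
    by (auto simp: power2_eq_iff)
  have "x \<noteq> - x" if "x \<noteq> 0"
  proof
    assume "x = - x"
    hence "2 * x = 0" by (metis add.right_inverse mult_2)
    thus False using assms that by simp
  qed
  thus ?thesis
    using x unfolding * by (cases "x = 0") (auto simp: qchar_def)
qed (auto simp: qchar_def)

text \<open>Grouping the field elements by their squares gives q as the sum of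
  \<open>1 + qchar y\<close> over all \<open>y\<close>, and the ones already add up to q.\<close>

lemma sum_qchar:
  assumes "(2 :: 'a::{field,finite}) \<noteq> 0"
  shows "(\<Sum>y\<in>UNIV. qchar (y :: 'a)) = 0"
proof -
  have "(\<Sum>y\<in>UNIV. \<Sum>x\<in>{x \<in> UNIV. x ^ 2 = (y :: 'a)}. 1) = (\<Sum>x\<in>(UNIV :: 'a set). 1 :: int)"
    by (rule sum.group) auto
  hence "(\<Sum>y\<in>UNIV. int (card {x. x ^ 2 = (y :: 'a)})) = int (card (UNIV :: 'a set))"
    by simp
  thus ?thesis
    by (simp add: card_square_roots[OF assms] sum.distrib)
qed

lemma qchar_mult_square:
  fixes x y :: "'a::{field,finite}"
  assumes "x \<noteq> 0"
  shows "qchar (x ^ 2 * y) = qchar y"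
proof -
  have "(\<exists>z. z ^ 2 = x ^ 2 * y) \<longleftrightarrow> (\<exists>z. z ^ 2 = y)"
  proof
    assume "\<exists>z. z ^ 2 = x ^ 2 * y"
    then obtain z where "z ^ 2 = x ^ 2 * y" by blast
    hence "(z / x) ^ 2 = y" using assms by (simp add: power_divide)
    thus "\<exists>z. z ^ 2 = y" by blast
  next
    assume "\<exists>z. z ^ 2 = y"
    then obtain z where "z ^ 2 = y" by blast
    hence "(x * z) ^ 2 = x ^ 2 * y" by (simp add: power_mult_distrib)
    thus "\<exists>z. z ^ 2 = x ^ 2 * y" by blast
  qed
  thus ?thesis
    using assms by (simp add: qchar_def)
qed

lemma qchar_square:
  fixes x :: "'a::{field,finite}"
  shows "x \<noteq> 0 \<Longrightarrow> qchar (x ^ 2) = 1"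
  by (auto simp: qchar_def)

lemma qchar_cases:
  fixes x :: "'a::{field,finite}"
  obtains "x = 0" | y where "y \<noteq> 0" "x = y ^ 2" | "x \<noteq> 0" "\<nexists>y. y ^ 2 = x" "qchar x = -1"
  by (metis qchar_def zero_power2)

lemma qchar_mult:
  fixes x y :: "'a::{field,finite}"
  assumes two: "(2 :: 'a) \<noteq> 0"
  shows "qchar (x * y) = qchar x * qchar y"
proof (cases x rule: qchar_cases)
  case 1
  thus ?thesis by (simp add: qchar_def)
next
  case (2 z)
  thus ?thesis by (simp add: qchar_mult_square qchar_square)
next
  case 3
  \<comment> \<open>Every summand of \<open>\<Sum>y. qchar (x * y) + qchar y\<close> is at most 0 and the sum vanishes.\<close>
  have le: "qchar (x * y) + qchar y \<le> 0" for y
  proof (cases y rule: qchar_cases)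
    case 1
    thus ?thesis by (simp add: qchar_def)
  next
    case (2 z)
    thus ?thesis using 3 by (simp add: mult.commute[of x] qchar_mult_square qchar_square)
  next
    case 3
    thus ?thesis by (simp add: qchar_def)
  qed
  have "(\<Sum>y\<in>UNIV. qchar (x * y)) = (\<Sum>y\<in>UNIV. qchar (y :: 'a))"
    by (rule sum.reindex_bij_witness[of _ "\<lambda>y. y / x" "\<lambda>y. x * y"]) (use 3 in auto)
  hence "(\<Sum>y\<in>UNIV. - (qchar (x * y) + qchar y)) = 0"
    by (simp add: sum.distrib sum_negf sum_subtractf sum_qchar[OF two])
  hence "- (qchar (x * y) + qchar y) = 0"
    by (rule sum_nonneg_0[rotated 2]) (simp_all only: neg_0_le_iff_le le UNIV_I finite)
  thus ?thesis
    using 3 by simp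
qed

lemma qchar_one: "qchar (1 :: 'a::{field,finite}) = 1"
  using qchar_square[of "1 :: 'a"] by simp

text \<open>For \<open>y \<noteq> 0\<close> the summand is
  \<open>qchar (y ^ 2 * (c / y - 1))\<close>, and the square drops out. If
  \<open>c \<noteq> 0\<close>, then \<open>c / y - 1\<close> runs through all elements except -1; if
  \<open>c = 0\<close>, it is constantly -1.\<close>

lemma qchar_convolution:
  fixes c :: "'a::{field,finite}"
  assumes two: "(2 :: 'a) \<noteq> 0"
  shows "(\<Sum>y\<in>UNIV. qchar y * qchar (c - y)) =
         qchar (-1 :: 'a) * (if c = 0 then int (card (UNIV :: 'a set)) - 1 else -1)"
proof -
  let ?U = "UNIV - {0 :: 'a}"
  have "(\<Sum>y\<in>UNIV. qchar y * qchar (c - y)) = (\<Sum>y\<in>?U. qchar y * qchar (c - y))"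
    by (rule sum.mono_neutral_right) (auto simp: qchar_def)
  also have "\<dots> = (\<Sum>y\<in>?U. qchar (c / y - 1))"
  proof (rule sum.cong[OF refl])
    fix y assume y: "y \<in> ?U"
    have "qchar y * qchar (c - y) = qchar (y * (c - y))"
      by (simp add: qchar_mult[OF two])
    also have "y * (c - y) = y ^ 2 * (c / y - 1)"
      using y by (simp add: field_simps power2_eq_square)
    also have "qchar \<dots> = qchar (c / y - 1)"
      using y by (simp add: qchar_mult_square)
    finally show "qchar y * qchar (c - y) = qchar (c / y - 1)" .
  qed
  also have "\<dots> = qchar (-1 :: 'a) * (if c = 0 then int (card (UNIV :: 'a set)) - 1 else -1)"
  proof (cases "c = 0")
    case True
    have "card (UNIV :: 'a set) \<ge> 1"
      using finite_UNIV_card_ge_0[where ?'a = 'a] by simp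
    thus ?thesis
      using True by (simp add: card_Diff_subset of_nat_diff)
  next
    case False
    have "(\<Sum>y\<in>?U. qchar (c / y - 1)) = (\<Sum>z\<in>UNIV - {-1}. qchar (z :: 'a))"
      by (rule sum.reindex_bij_witness[of _ "\<lambda>z. c / (z + 1)" "\<lambda>y. c / y - 1"])
         (use False in \<open>auto simp: eq_neg_iff_add_eq_0\<close>)
    also have "\<dots> = - qchar (-1 :: 'a)"
      by (simp add: sum_diff1 sum_qchar[OF two])
    finally show ?thesis
      using False by simp
  qed
  finally show ?thesis .
qed

text \<open>Closed form, for odd \<open>q\<close>, of the \<open>r\<close>-fold additive convolution power of \<open>qchar\<close>.\<close>

definition qchar_conv :: "nat \<Rightarrow> 'a::{field,finite} \<Rightarrow> real" where
  "qchar_conv r c =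
    (if r = 0 then of_bool (c = 0)
     else qchar ((-1 :: 'a) ^ (r div 2)) *
       (if even r then real (card (UNIV :: 'a set)) ^ (r div 2 - 1) *
           (if c = 0 then real (card (UNIV :: 'a set)) - 1 else -1)
        else real (card (UNIV :: 'a set)) ^ (r div 2) * qchar c))"

text \<open>For even \<open>r > 0\<close> the function is a multiple of
  \<open>q \<delta> - 1\<close>, with \<delta> the indicator of 0; the constant part is killed by
  the vanishing sum of \<open>qchar\<close>. For odd \<open>r\<close> the convolution square of
  \<open>qchar\<close> appears. The case \<open>r = 0\<close> is a bare \<delta> and stands
  apart.\<close>

lemma qchar_conv_Suc:
  fixes c :: "'a::{field,finite}"
  assumes two: "(2 :: 'a) \<noteq> 0"
  shows "(\<Sum>y\<in>UNIV. qchar y * qchar_conv r (c - y)) = qchar_conv (Suc r) c"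
proof -
  let ?q = "real (card (UNIV :: 'a set))"
  have sum0: "(\<Sum>y\<in>UNIV. real_of_int (qchar (y :: 'a))) = 0"
    using sum_qchar[OF two] by (metis of_int_0 of_int_sum)
  have delta: "(\<Sum>y\<in>UNIV. real_of_int (qchar y) * of_bool (c = y)) = qchar c"
    by (subst sum.remove[of _ c]) auto
  consider "r = 0" | "r \<noteq> 0" "even r" | "odd r" by blast
  thus ?thesis
  proof cases
    case 1
    thus ?thesis
      using delta by (simp add: qchar_conv_def qchar_one)
  next
    case 2
    define A where "A = qchar ((-1 :: 'a) ^ (r div 2)) * ?q ^ (r div 2 - 1)"
    have "?q ^ (r div 2) = ?q ^ (r div 2 - 1) * ?q"
      using 2 by (cases "r div 2") (auto elim!: evenE)
    hence "qchar_conv (Suc r) c = A * ?q * qchar c"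
      using 2 by (simp add: qchar_conv_def A_def)
    moreover have conv: "qchar_conv r (c - y) = A * (?q * of_bool (c = y) - 1)" for y
      using 2 by (simp add: qchar_conv_def A_def)
    moreover have "(\<Sum>y\<in>UNIV. qchar y * qchar_conv r (c - y)) =
        (\<Sum>y\<in>UNIV. A * ?q * (real_of_int (qchar y) * of_bool (c = y)) - A * real_of_int (qchar y))"
      unfolding conv by (simp add: right_diff_distrib mult_ac)
    hence "(\<Sum>y\<in>UNIV. qchar y * qchar_conv r (c - y)) = A * ?q * qchar c"
      by (simp only: sum_subtractf sum_distrib_left[symmetric] delta sum0 mult_zero_right diff_zero)
    ultimately show ?thesis
      by simp
  next
    case 3
    define A where "A = qchar ((-1 :: 'a) ^ (r div 2)) * ?q ^ (r div 2)"
    \<comment> \<open>For odd \<open>r\<close>, \<open>Suc r div 2\<close> exceeds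
      \<open>r div 2\<close> by one, so the sign gains the factor \<open>qchar (-1)\<close> supplied
      by the convolution square.\<close>
    have neg: "qchar (- ((-1 :: 'a) ^ (r div 2))) = qchar (-1 :: 'a) * qchar ((-1 :: 'a) ^ (r div 2))"
      using qchar_mult[OF two, of "-1" "(-1) ^ (r div 2)"] by simp
    have conv: "qchar_conv r (c - y) = A * qchar (c - y)" for y
      using 3 by (auto simp: qchar_conv_def A_def)
    have "(\<Sum>y\<in>UNIV. qchar y * qchar_conv r (c - y)) = A * real_of_int (\<Sum>y\<in>UNIV. qchar y * qchar (c - y))"
      unfolding conv by (simp add: sum_distrib_left mult.left_commute)
    also have "\<dots> = qchar_conv (Suc r) c"
      unfolding qchar_convolution[OF two] using 3 by (simp add: qchar_conv_def A_def neg)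
    finally show ?thesis .
  qed
qed

section \<open>Solution counts as convolutions of one-variable weights\<close>

lemma card_PiE_insert_sum_eq:
  fixes g :: "nat \<Rightarrow> 'b \<Rightarrow> 'a::{ab_group_add,finite}"
  assumes "finite I" "j \<notin> I" "finite B"
  shows "card {x \<in> insert j I \<rightarrow>\<^sub>E B. (\<Sum>i\<in>insert j I. g i (x i)) = c} =
         (\<Sum>y\<in>UNIV. card {z \<in> B. g j z = y} * card {x \<in> I \<rightarrow>\<^sub>E B. (\<Sum>i\<in>I. g i (x i)) = c - y})"
proof -
  let ?F = "\<lambda>c. {x \<in> I \<rightarrow>\<^sub>E B. (\<Sum>i\<in>I. g i (x i)) = c}"
  have fin: "finite (?F c)" for c
    using finite_PiE[OF \<open>finite I\<close>, of "\<lambda>_. B"] \<open>finite B\<close> by simp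
  have sum_upd: "(\<Sum>i\<in>I. g i ((x(j := z)) i)) = (\<Sum>i\<in>I. g i (x i))" for x z
    using \<open>j \<notin> I\<close> by (intro sum.cong) auto
  have sum_upd': "(\<Sum>i\<in>insert j I. g i ((x(j := z)) i)) = c \<longleftrightarrow> (\<Sum>i\<in>I. g i (x i)) = c - g j z" for x z
    using assms(1,2) sum_upd[of x z] by (simp add: eq_diff_eq del: fun_upd_apply) (simp add: add.commute)
  have filter_image: "{y \<in> f ` S. P y} = f ` {s \<in> S. P (f s)}"
    for f :: "'b \<times> (nat \<Rightarrow> 'b) \<Rightarrow> nat \<Rightarrow> 'b" and S P
    by blast
  have "{p \<in> B \<times> (I \<rightarrow>\<^sub>E B). (\<Sum>i\<in>insert j I. g i ((\<lambda>(z, x). x(j := z)) p i)) = c} =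
      (SIGMA z:B. ?F (c - g j z))"
    by (rule set_eqI)
       (simp only: split_paired_all mem_Collect_eq mem_Sigma_iff case_prod_conv sum_upd' conj_assoc)
  hence "{x \<in> insert j I \<rightarrow>\<^sub>E B. (\<Sum>i\<in>insert j I. g i (x i)) = c} =
      (\<lambda>(z, x). x(j := z)) ` (SIGMA z:B. ?F (c - g j z))"
    unfolding PiE_insert_eq filter_image by simp
  moreover have "inj_on (\<lambda>(z, x). x(j := z)) (SIGMA z:B. ?F (c - g j z))"
    by (rule inj_on_subset[OF inj_combinator[OF \<open>j \<notin> I\<close>, of "\<lambda>_. B"]]) auto
  ultimately have "card {x \<in> insert j I \<rightarrow>\<^sub>E B. (\<Sum>i\<in>insert j I. g i (x i)) = c} =
      (\<Sum>z\<in>B. card (?F (c - g j z)))"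
    using fin \<open>finite B\<close> by (simp add: card_image)
  \<comment> \<open>Grouping \<open>z\<close> by the value \<open>y\<close> of its term turns the
    sum over \<open>B\<close> into an additive convolution.\<close>
  also have "\<dots> = (\<Sum>y\<in>UNIV. \<Sum>z\<in>{z \<in> B. g j z = y}. card (?F (c - g j z)))"
    using \<open>finite B\<close> by (intro sum.group[symmetric]) auto
  also have "\<dots> = (\<Sum>y\<in>UNIV. card {z \<in> B. g j z = y} * card (?F (c - y)))"
    by (intro sum.cong) auto
  finally show ?thesis .
qed

lemma card_monomial_eq:
  fixes a y :: "'a::{field,finite}"
  assumes "a \<noteq> 0" "square \<Longrightarrow> (2 :: 'a) \<noteq> 0"
  shows "int (card {x. a * x ^ (if square then 2 else 1) = y}) =
         1 + (if square then qchar a else 0) * qchar y"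
proof (cases square)
  case True
  hence two: "(2 :: 'a) \<noteq> 0" using assms(2) by blast
  have "a * x ^ 2 = y \<longleftrightarrow> x ^ 2 = y / a" for x
    using assms(1) by (simp add: eq_divide_eq mult.commute)
  hence "int (card {x. a * x ^ 2 = y}) = 1 + qchar (y / a)"
    using card_square_roots[OF two] by simp
  \<comment> \<open>Up to the square of \<open>inverse a\<close>, dividing by \<open>a\<close> is
    multiplying by \<open>a\<close>, which gives access to multiplicativity.\<close>
  also have "y / a = (inverse a) ^ 2 * (a * y)"
    using assms(1) by (simp add: divide_inverse power2_eq_square)
  also have "qchar \<dots> = qchar (a * y)"
    using assms(1) by (intro qchar_mult_square) simp
  also have "\<dots> = qchar a * qchar y"
    by (rule qchar_mult[OF two])
  finally show ?thesis
    using True by simp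
next
  case False
  have "{x. a * x = y} = {y / a}"
    using assms(1) by auto
  thus ?thesis
    using False by simp
qed

text \<open>The parameter \<epsilon> records whether 0 is removed from the domain;
  \<open>x = 0\<close> only ever contributes to \<open>y = 0\<close>. Affine and torus counts thus
  share one computation.\<close>

lemma card_monomial_eq_weight:
  fixes a y :: "'a::{field,finite}" and \<epsilon> :: real
  assumes "a \<noteq> 0" "square \<Longrightarrow> (2 :: 'a) \<noteq> 0"
    and B: "B = UNIV \<and> \<epsilon> = 0 \<or> B = UNIV - {0} \<and> \<epsilon> = 1"
  shows "real (card {x \<in> B. a * x ^ (if square then 2 else 1) = y}) =
         1 - \<epsilon> * of_bool (y = 0) + (if square then qchar a else 0) * qchar y"
proof -
  let ?S = "{x. a * x ^ (if square then 2 else 1) = y}"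
  have "int (card ?S) = 1 + (if square then qchar a else 0) * qchar y"
    using assms by (intro card_monomial_eq) auto
  from arg_cong[OF this, of real_of_int]
  have S: "real (card ?S) = 1 + (if square then qchar a else 0) * qchar y"
    by simp
  have "real (card (S - {z})) = real (card S) - of_bool (z \<in> S)" for S :: "'a set" and z
    using arg_cong[OF card_Suc_Diff1[of S z], of real] by (cases "z \<in> S") auto
  hence card_diff: "real (card (?S - {0})) = real (card ?S) - of_bool (0 \<in> ?S)" .
  have zero_iff: "0 \<in> ?S \<longleftrightarrow> y = 0"
    by auto
  have filter_nonzero: "{x \<in> UNIV - {0}. a * x ^ (if square then 2 else 1) = y} = ?S - {0}"
    by auto
  from B show ?thesis
  proof (elim disjE conjE)
    assume "B = UNIV" "\<epsilon> = 0"
    thus ?thesis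
      using S by simp
  next
    assume "B = UNIV - {0}" "\<epsilon> = 1"
    thus ?thesis
      by (simp only: filter_nonzero card_diff zero_iff S)
  qed
qed

text \<open>The count is the convolution over \<open>i \<in> I\<close> of the weights
  \<open>1 - \<epsilon> \<delta>\<^sub>0 + \<chi>\<^sub>i qchar\<close>. Convolving with the constant 1 gives a constant, which is determined
  by the total mass; the summand for \<open>T\<close> takes \<open>\<chi>\<^sub>i qchar\<close> at \<open>i \<in> T\<close> and
  \<open>- \<epsilon> \<delta>\<^sub>0\<close> elsewhere.\<close>

lemma card_diagonal_linear_quadratic:
  fixes a :: "nat \<Rightarrow> 'a::{field,finite}" and J :: "nat set" and \<epsilon> :: real
  defines "q \<equiv> real (card (UNIV :: 'a set))"
    and "\<chi> \<equiv> (\<lambda>i. if i \<in> J then real_of_int (qchar (a i)) else 0)"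
  assumes "finite I" "\<And>i. i \<in> I \<Longrightarrow> a i \<noteq> 0" "I \<inter> J \<noteq> {} \<Longrightarrow> (2 :: 'a) \<noteq> 0"
    and B: "B = UNIV \<and> \<epsilon> = 0 \<or> B = UNIV - {0} \<and> \<epsilon> = 1"
  shows "real (card {x \<in> I \<rightarrow>\<^sub>E B. (\<Sum>i\<in>I. a i * x i ^ (if i \<in> J then 2 else 1)) = c}) =
    ((q - \<epsilon>) ^ card I - (- \<epsilon>) ^ card I) / q +
    (\<Sum>T\<in>Pow I. (- \<epsilon>) ^ (card I - card T) * (\<Prod>i\<in>T. \<chi> i) * qchar_conv (card T) c)"
  using assms(3-5)
proof (induction I arbitrary: c rule: finite_induct)
  case empty
  have "{x. x = (\<lambda>_. undefined) \<and> c = 0} = (if c = 0 then {\<lambda>_. undefined :: 'a} else {})"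
    by auto
  thus ?case
    by (simp add: qchar_conv_def eq_commute[of 0 c])
next
  case (insert j I)
  let ?g = "\<lambda>i z. a i * z ^ (if i \<in> J then 2 else 1)"
  define M where "M = (\<lambda>c. real (card {x \<in> I \<rightarrow>\<^sub>E B. (\<Sum>i\<in>I. ?g i (x i)) = c}))"
  define t where "t = (\<lambda>T (c :: 'a). (- \<epsilon>) ^ (card I - card T) * (\<Prod>i\<in>T. \<chi> i) * qchar_conv (card T) c)"
  define \<alpha> where "\<alpha> = ((q - \<epsilon>) ^ card I - (- \<epsilon>) ^ card I) / q"
  have q: "q > 0"
    unfolding q_def using finite_UNIV_card_ge_0[where ?'a = 'a] by simp
  have IH: "M c = \<alpha> + (\<Sum>T\<in>Pow I. t T c)" for c
    unfolding M_def \<alpha>_def t_def using insert by auto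
  have cardB: "real (card B) = q - \<epsilon>"
    using B q by (auto simp: q_def card_Diff_subset of_nat_diff Suc_leI)
  \<comment> \<open>Total mass of \<open>M\<close>: each point of the box is counted at exactly one
    value \<open>c\<close>. This evaluates the convolution with the constant 1.\<close>
  have "(\<Sum>c\<in>UNIV. \<Sum>x\<in>{x \<in> I \<rightarrow>\<^sub>E B. (\<Sum>i\<in>I. ?g i (x i)) = c}. 1) = (\<Sum>x\<in>I \<rightarrow>\<^sub>E B. 1 :: real)"
    using \<open>finite I\<close> by (intro sum.group) (auto intro: finite_PiE)
  hence "(\<Sum>c\<in>UNIV. M c) = real (card (I \<rightarrow>\<^sub>E B))"
    by (simp add: M_def)
  also have "\<dots> = (q - \<epsilon>) ^ card I"
    using \<open>finite I\<close> cardB by (simp add: card_PiE)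
  finally have "(\<Sum>c\<in>UNIV. M c) = (q - \<epsilon>) ^ card I" .
  moreover have "(\<Sum>y\<in>UNIV. M (c - y)) = (\<Sum>y\<in>UNIV. M y)"
    by (rule sum.reindex_bij_witness[of _ "\<lambda>y. c - y" "\<lambda>y. c - y"]) auto
  ultimately have mass: "(\<Sum>y\<in>UNIV. M (c - y)) = (q - \<epsilon>) ^ card I"
    by simp
  have delta: "(\<Sum>y\<in>UNIV. of_bool (y = 0) * M (c - y)) = M c"
    by (subst sum.remove[of _ 0]) auto
  \<comment> \<open>The constant \<alpha> disappears because \<open>qchar\<close> sums to 0. For
    \<open>j\<close> outside \<open>J\<close> the characteristic may be 2, but then
    \<open>\<chi> j = 0\<close> and both sides vanish.\<close>
  have conv: "\<chi> j * (\<Sum>y\<in>UNIV. qchar y * M (c - y)) =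
      (\<Sum>T\<in>Pow I. \<chi> j * ((- \<epsilon>) ^ (card I - card T) * (\<Prod>i\<in>T. \<chi> i)) * qchar_conv (Suc (card T)) c)"
  proof (cases "j \<in> J")
    case True
    hence two: "(2 :: 'a) \<noteq> 0" using insert.prems by auto
    have sum0: "(\<Sum>y\<in>UNIV. real_of_int (qchar (y :: 'a))) = 0"
      using sum_qchar[OF two] by (metis of_int_0 of_int_sum)
    have "(\<Sum>y\<in>UNIV. qchar y * M (c - y)) =
        (\<Sum>y\<in>UNIV. qchar (y :: 'a) * \<alpha>) + (\<Sum>y\<in>UNIV. \<Sum>T\<in>Pow I. qchar y * t T (c - y))"
      by (simp add: IH ring_distribs sum.distrib sum_distrib_left)
    also have "(\<Sum>y\<in>UNIV. qchar (y :: 'a) * \<alpha>) = (\<Sum>y\<in>UNIV. real_of_int (qchar (y :: 'a))) * \<alpha>"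
      by (simp only: sum_distrib_right)
    also have "(\<Sum>y\<in>UNIV. \<Sum>T\<in>Pow I. qchar y * t T (c - y)) =
        (\<Sum>T\<in>Pow I. \<Sum>y\<in>UNIV. qchar y * t T (c - y))"
      by (rule sum.swap)
    also have "\<dots> = (\<Sum>T\<in>Pow I. (- \<epsilon>) ^ (card I - card T) * (\<Prod>i\<in>T. \<chi> i) * qchar_conv (Suc (card T)) c)"
      unfolding t_def qchar_conv_Suc[OF two, symmetric] sum_distrib_left
      by (intro sum.cong) (simp_all add: mult_ac)
    finally show ?thesis
      by (simp add: sum0 sum_distrib_left mult_ac)
  qed (simp add: \<chi>_def)
  have "real (card {x \<in> insert j I \<rightarrow>\<^sub>E B. (\<Sum>i\<in>insert j I. ?g i (x i)) = c}) =
      (\<Sum>y\<in>UNIV. (1 - \<epsilon> * of_bool (y = 0) + \<chi> j * qchar y) * M (c - y))"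
  proof -
    have "real (card {z \<in> B. ?g j z = y}) = 1 - \<epsilon> * of_bool (y = 0) + \<chi> j * qchar y" for y
      using card_monomial_eq_weight[OF _ _ B, of "a j" "j \<in> J" y] insert.prems by (auto simp: \<chi>_def)
    thus ?thesis
      using card_PiE_insert_sum_eq[of I j B ?g c] insert.hyps by (simp add: M_def)
  qed
  also have "\<dots> = (\<Sum>y\<in>UNIV. M (c - y) - \<epsilon> * (of_bool (y = 0) * M (c - y)) + \<chi> j * (qchar y * M (c - y)))"
    by (intro sum.cong) (simp_all add: algebra_simps)
  also have "\<dots> = (q - \<epsilon>) ^ card I - \<epsilon> * M c + \<chi> j * (\<Sum>y\<in>UNIV. qchar y * M (c - y))"
    by (simp only: sum.distrib sum_subtractf sum_distrib_left[symmetric] mass delta)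
  also have "\<dots> = ((q - \<epsilon>) ^ card I - \<epsilon> * \<alpha>) + ((\<Sum>T\<in>Pow I. - \<epsilon> * t T c) +
      (\<Sum>T\<in>Pow I. \<chi> j * ((- \<epsilon>) ^ (card I - card T) * (\<Prod>i\<in>T. \<chi> i)) * qchar_conv (Suc (card T)) c))"
    unfolding conv IH[of c] by (simp add: ring_distribs sum_distrib_left sum_negf)
  \<comment> \<open>The recursion for the constant part: multiply by \<open>q\<close> and insert the
    definition of \<alpha>.\<close>
  also have "(q - \<epsilon>) ^ card I - \<epsilon> * \<alpha> =
      ((q - \<epsilon>) ^ card (insert j I) - (- \<epsilon>) ^ card (insert j I)) / q"
    using q insert.hyps by (simp add: \<alpha>_def field_simps)
  also have "(\<Sum>T\<in>Pow I. - \<epsilon> * t T c) = (\<Sum>T\<in>Pow I. (- \<epsilon>) ^ (card (insert j I) - card T) *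
      (\<Prod>i\<in>T. \<chi> i) * qchar_conv (card T) c)"
  proof (intro sum.cong refl)
    fix T assume "T \<in> Pow I"
    hence "card T \<le> card I"
      using \<open>finite I\<close> by (simp add: card_mono)
    thus "- \<epsilon> * t T c = (- \<epsilon>) ^ (card (insert j I) - card T) * (\<Prod>i\<in>T. \<chi> i) * qchar_conv (card T) c"
      using insert.hyps by (simp add: t_def Suc_diff_le)
  qed
  \<comment> \<open>The subsets of \<open>insert j I\<close> split by membership of
    \<open>j\<close>: those without \<open>j\<close> carry the factor \<open>- \<epsilon>\<close>,
    those with \<open>j\<close> arise here from the weight \<open>\<chi> j\<close>.\<close>
  also have "(\<Sum>T\<in>Pow I. \<chi> j * ((- \<epsilon>) ^ (card I - card T) * (\<Prod>i\<in>T. \<chi> i)) * qchar_conv (Suc (card T)) c) =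
      (\<Sum>T\<in>insert j ` Pow I. (- \<epsilon>) ^ (card (insert j I) - card T) *
      (\<Prod>i\<in>T. \<chi> i) * qchar_conv (card T) c)"
  proof (subst sum.reindex)
    show "inj_on (insert j) (Pow I)"
      using \<open>j \<notin> I\<close> by (auto simp: inj_on_def)
    show "(\<Sum>T\<in>Pow I. \<chi> j * ((- \<epsilon>) ^ (card I - card T) * (\<Prod>i\<in>T. \<chi> i)) * qchar_conv (Suc (card T)) c) =
      sum ((\<lambda>T. (- \<epsilon>) ^ (card (insert j I) - card T) * (\<Prod>i\<in>T. \<chi> i) * qchar_conv (card T) c) \<circ> insert j) (Pow I)"
    proof (intro sum.cong refl)
      fix T assume "T \<in> Pow I"
      hence "finite T" "j \<notin> T"
        using \<open>finite I\<close> \<open>j \<notin> I\<close> by (auto intro: finite_subset)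
      thus "\<chi> j * ((- \<epsilon>) ^ (card I - card T) * (\<Prod>i\<in>T. \<chi> i)) * qchar_conv (Suc (card T)) c =
        ((\<lambda>T. (- \<epsilon>) ^ (card (insert j I) - card T) * (\<Prod>i\<in>T. \<chi> i) * qchar_conv (card T) c) \<circ> insert j) T"
        using insert.hyps by (simp add: mult_ac)
    qed
  qed
  also have "(\<Sum>T\<in>Pow I. (- \<epsilon>) ^ (card (insert j I) - card T) * (\<Prod>i\<in>T. \<chi> i) * qchar_conv (card T) c) +
      (\<Sum>T\<in>insert j ` Pow I. (- \<epsilon>) ^ (card (insert j I) - card T) * (\<Prod>i\<in>T. \<chi> i) * qchar_conv (card T) c) =
      (\<Sum>T\<in>Pow (insert j I). (- \<epsilon>) ^ (card (insert j I) - card T) * (\<Prod>i\<in>T. \<chi> i) * qchar_conv (card T) c)"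
    unfolding Pow_insert using insert.hyps by (intro sum.union_disjoint[symmetric]) auto
  finally show ?case .
qed

section \<open>Zeros of linear-quadratic forms\<close>

lemma esym_0: "finite J \<Longrightarrow> esym J z 0 = 1"
proof -
  assume "finite J"
  hence "{T. T \<subseteq> J \<and> card T = 0} = {{}}"
    by (auto dest: finite_subset)
  thus ?thesis by (simp add: esym_def)
qed

lemma esym_card: "finite J \<Longrightarrow> esym J z (card J) = (\<Prod>i\<in>J. z i)"
proof -
  assume "finite J"
  hence "{T. T \<subseteq> J \<and> card T = card J} = {J}"
    using card_subset_eq by blast
  thus ?thesis by (simp add: esym_def)
qed

lemma qchar_0: "qchar (0 :: 'a::{field,finite}) = 0"
  by (simp add: qchar_def)

lemma qchar_conv_odd_0: "odd r \<Longrightarrow> qchar_conv r (0 :: 'a::{field,finite}) = 0"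
  by (auto simp: qchar_conv_def qchar_0 odd_pos)

lemma qchar_conv_even_0:
  "j > 0 \<Longrightarrow> qchar_conv (2 * j) (0 :: 'a::{field,finite}) =
    qchar ((-1 :: 'a) ^ j) * real (card (UNIV :: 'a set)) ^ (j - 1) * (real (card (UNIV :: 'a set)) - 1)"
  by (simp add: qchar_conv_def)

text \<open>Grouping by \<open>card T div 2\<close> puts sizes \<open>2 * j\<close> and
  \<open>2 * j + 1\<close> together; the odd sizes contribute nothing by the hypothesis on
  \<open>f\<close>.\<close>

lemma sum_even_subsets_eq_esym:
  fixes z :: "nat \<Rightarrow> real" and f :: "nat \<Rightarrow> real"
  assumes "finite J" and f: "\<And>r. odd r \<Longrightarrow> f r = 0"
  shows "(\<Sum>T\<in>Pow J. (\<Prod>i\<in>T. z i) * f (card T)) = (\<Sum>j\<in>{0..card J div 2}. esym J z (2 * j) * f (2 * j))"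
proof -
  have "(\<Sum>T\<in>Pow J. (\<Prod>i\<in>T. z i) * f (card T)) =
      (\<Sum>j\<in>{0..card J div 2}. \<Sum>T\<in>{T \<in> Pow J. card T div 2 = j}. (\<Prod>i\<in>T. z i) * f (card T))"
    using \<open>finite J\<close> by (intro sum.group[symmetric]) (auto intro!: div_le_mono card_mono)
  also have "\<dots> = (\<Sum>j\<in>{0..card J div 2}. esym J z (2 * j) * f (2 * j))"
  proof (rule sum.cong[OF refl])
    fix j
    have "(\<Sum>T\<in>{T \<in> Pow J. card T div 2 = j}. (\<Prod>i\<in>T. z i) * f (card T)) =
        (\<Sum>T\<in>{T. T \<subseteq> J \<and> card T = 2 * j}. (\<Prod>i\<in>T. z i) * f (2 * j))"
    proof (rule sum.mono_neutral_cong_right)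
      show "finite {T \<in> Pow J. card T div 2 = j}"
        using \<open>finite J\<close> by simp
      show "\<forall>T\<in>{T \<in> Pow J. card T div 2 = j} - {T. T \<subseteq> J \<and> card T = 2 * j}.
          (\<Prod>i\<in>T. z i) * f (card T) = 0"
      proof
        fix T assume "T \<in> {T \<in> Pow J. card T div 2 = j} - {T. T \<subseteq> J \<and> card T = 2 * j}"
        hence "odd (card T)" by auto
        thus "(\<Prod>i\<in>T. z i) * f (card T) = 0" using f by simp
      qed
    qed auto
    thus "(\<Sum>T\<in>{T \<in> Pow J. card T div 2 = j}. (\<Prod>i\<in>T. z i) * f (card T)) =
        esym J z (2 * j) * f (2 * j)"
      by (simp add: esym_def sum_distrib_right)
  qed
  finally show ?thesis .
qed

text \<open>With \<open>\<epsilon> = 0\<close> the factor \<open>0 ^ (card I - card T)\<close>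
  leaves only \<open>T = I\<close>, and its product of weights vanishes as soon as one variable is
  linear.\<close>

lemma card_diagonal_affine_zeros:
  fixes a :: "nat \<Rightarrow> 'a::{field,finite}"
  defines "q \<equiv> real (card (UNIV :: 'a set))"
  assumes "finite I" "I \<noteq> {}" "J \<subseteq> I" "\<And>i. i \<in> I \<Longrightarrow> a i \<noteq> 0" "J \<noteq> {} \<Longrightarrow> (2 :: 'a) \<noteq> 0"
  shows "real (card {x \<in> I \<rightarrow>\<^sub>E UNIV. (\<Sum>i\<in>I. a i * x i ^ (if i \<in> J then 2 else 1)) = 0}) =
    q ^ (card I - 1) +
    (if J = I then (\<Prod>i\<in>I. real_of_int (qchar (a i))) * qchar_conv (card I) (0 :: 'a) else 0)"
proof -
  define \<chi> where "\<chi> = (\<lambda>i. if i \<in> J then real_of_int (qchar (a i)) else 0)"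
  have q: "q > 0"
    unfolding q_def using finite_UNIV_card_ge_0[where ?'a = 'a] by simp
  have cI: "card I > 0"
    using assms by (simp add: card_gt_0_iff)
  have "real (card {x \<in> I \<rightarrow>\<^sub>E UNIV. (\<Sum>i\<in>I. a i * x i ^ (if i \<in> J then 2 else 1)) = 0}) =
      ((q - 0) ^ card I - (- 0) ^ card I) / q +
      (\<Sum>T\<in>Pow I. (- 0) ^ (card I - card T) * (\<Prod>i\<in>T. \<chi> i) * qchar_conv (card T) (0 :: 'a))"
    unfolding q_def \<chi>_def using assms by (intro card_diagonal_linear_quadratic) auto
  also have "((q - 0) ^ card I - (- 0) ^ card I) / q = q ^ (card I - 1)"
    using q cI by (simp add: power_diff)
  also have "(\<Sum>T\<in>Pow I. (- 0) ^ (card I - card T) * (\<Prod>i\<in>T. \<chi> i) * qchar_conv (card T) (0 :: 'a)) =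
      (\<Sum>T\<in>{I}. (- 0) ^ (card I - card T) * (\<Prod>i\<in>T. \<chi> i) * qchar_conv (card T) (0 :: 'a))"
  proof (rule sum.mono_neutral_right)
    show "\<forall>T\<in>Pow I - {I}. (- 0) ^ (card I - card T) * (\<Prod>i\<in>T. \<chi> i) * qchar_conv (card T) (0 :: 'a) = 0"
    proof
      fix T assume "T \<in> Pow I - {I}"
      hence "card T < card I"
        using \<open>finite I\<close> by (intro psubset_card_mono) auto
      thus "(- 0) ^ (card I - card T) * (\<Prod>i\<in>T. \<chi> i) * qchar_conv (card T) (0 :: 'a) = 0"
        by (simp add: power_0_left)
    qed
  qed (use \<open>finite I\<close> in auto)
  also have "\<dots> = (\<Prod>i\<in>I. \<chi> i) * qchar_conv (card I) (0 :: 'a)"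
    by simp
  also have "(\<Prod>i\<in>I. \<chi> i) = (if J = I then \<Prod>i\<in>I. real_of_int (qchar (a i)) else 0)"
    using \<open>finite I\<close> \<open>J \<subseteq> I\<close> by (auto simp: \<chi>_def)
  finally show ?thesis
    by simp
qed

text \<open>With \<open>\<epsilon> = 1\<close> all \<open>T\<close> in \<open>J\<close> survive, but
  at 0 odd convolution powers vanish, so the sign is \<open>(-1) ^ card I\<close> throughout. The
  empty set contributes that sign alone, and adding it changes the numerator term
  \<open>- (-1) ^ card I\<close> into \<open>(-1) ^ card I * (q - 1)\<close>.\<close>

lemma card_diagonal_torus_zeros:
  fixes a :: "nat \<Rightarrow> 'a::{field,finite}"
  defines "q \<equiv> real (card (UNIV :: 'a set))"
  assumes "finite I" "J \<subseteq> I" "\<And>i. i \<in> I \<Longrightarrow> a i \<noteq> 0" "J \<noteq> {} \<Longrightarrow> (2 :: 'a) \<noteq> 0"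
  shows "real (card {x \<in> I \<rightarrow>\<^sub>E (UNIV - {0}). (\<Sum>i\<in>I. a i * x i ^ (if i \<in> J then 2 else 1)) = 0}) =
    ((q - 1) ^ card I + (-1) ^ card I * (q - 1)) / q +
    (-1) ^ card I * (q - 1) * (\<Sum>j\<in>{1..card J div 2}. real_of_int (qchar ((-1 :: 'a) ^ j)) *
      esym J (\<lambda>i. real_of_int (qchar (a i))) (2 * j) * q ^ (j - 1))"
proof -
  define \<eta> where "\<eta> = (\<lambda>i. real_of_int (qchar (a i)))"
  define \<chi> where "\<chi> = (\<lambda>i. if i \<in> J then \<eta> i else 0)"
  define f where "f = (\<lambda>r. qchar_conv r (0 :: 'a))"
  have "finite J"
    using assms by (auto intro: finite_subset)
  have q: "q > 0"
    unfolding q_def using finite_UNIV_card_ge_0[where ?'a = 'a] by simp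
  have "real (card {x \<in> I \<rightarrow>\<^sub>E (UNIV - {0}). (\<Sum>i\<in>I. a i * x i ^ (if i \<in> J then 2 else 1)) = 0}) =
      ((q - 1) ^ card I - (- 1) ^ card I) / q +
      (\<Sum>T\<in>Pow I. (- 1) ^ (card I - card T) * (\<Prod>i\<in>T. \<chi> i) * f (card T))"
    unfolding q_def \<chi>_def \<eta>_def f_def using assms by (intro card_diagonal_linear_quadratic) auto
  also have "(\<Sum>T\<in>Pow I. (- 1) ^ (card I - card T) * (\<Prod>i\<in>T. \<chi> i) * f (card T)) =
      (\<Sum>T\<in>Pow J. (- 1) ^ card I * ((\<Prod>i\<in>T. \<eta> i) * f (card T)))"
  proof (rule sum.mono_neutral_cong_right)
    show "\<forall>T\<in>Pow I - Pow J. (- 1) ^ (card I - card T) * (\<Prod>i\<in>T. \<chi> i) * f (card T) = 0"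
    proof
      fix T assume T: "T \<in> Pow I - Pow J"
      hence "finite T" using \<open>finite I\<close> by (auto intro: finite_subset)
      hence "(\<Prod>i\<in>T. \<chi> i) = 0" using T by (auto simp: \<chi>_def)
      thus "(- 1) ^ (card I - card T) * (\<Prod>i\<in>T. \<chi> i) * f (card T) = 0" by simp
    qed
    fix T assume T: "T \<in> Pow J"
    hence le: "card T \<le> card I"
      using assms(2,3) by (intro card_mono) auto
    have "(\<Prod>i\<in>T. \<chi> i) = (\<Prod>i\<in>T. \<eta> i)"
      using T by (intro prod.cong) (auto simp: \<chi>_def)
    moreover have "(- 1) ^ (card I - card T) * f (card T) = (- 1) ^ card I * f (card T)"
    proof (cases "odd (card T)")
      case True
      thus ?thesis by (simp add: f_def qchar_conv_odd_0)
    next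
      case False
      thus ?thesis using le by (auto simp: uminus_power_if)
    qed
    ultimately show "(- 1) ^ (card I - card T) * (\<Prod>i\<in>T. \<chi> i) * f (card T) =
        (- 1) ^ card I * ((\<Prod>i\<in>T. \<eta> i) * f (card T))"
      by (simp add: mult_ac)
  qed (use assms in auto)
  also have "\<dots> = (- 1) ^ card I * (\<Sum>j\<in>{0..card J div 2}. esym J \<eta> (2 * j) * f (2 * j))"
    unfolding sum_distrib_left[symmetric]
    using sum_even_subsets_eq_esym[OF \<open>finite J\<close>, of f] by (simp add: f_def qchar_conv_odd_0)
  also have "(\<Sum>j\<in>{0..card J div 2}. esym J \<eta> (2 * j) * f (2 * j)) =
      esym J \<eta> 0 * f 0 + (\<Sum>j\<in>{1..card J div 2}. esym J \<eta> (2 * j) * f (2 * j))"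
    by (simp add: sum.atLeast_Suc_atMost)
  also have "esym J \<eta> 0 * f 0 = 1"
    using \<open>finite J\<close> by (simp add: esym_0 f_def qchar_conv_def)
  also have "(\<Sum>j\<in>{1..card J div 2}. esym J \<eta> (2 * j) * f (2 * j)) =
      (q - 1) * (\<Sum>j\<in>{1..card J div 2}. real_of_int (qchar ((-1 :: 'a) ^ j)) * esym J \<eta> (2 * j) * q ^ (j - 1))"
    unfolding sum_distrib_left by (intro sum.cong) (simp_all add: f_def qchar_conv_even_0 q_def)
  finally show ?thesis
    using q unfolding \<eta>_def[symmetric] by (simp add: field_simps)
qed

text \<open>Translation by 1 permutes the field, so q times 1 is 0; for odd q, \<open>2 = 0\<close>
  would then give \<open>1 = 0\<close>.\<close>

lemma two_neq_zero_if_even_card_minus_one: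
  assumes "even (card (UNIV :: 'a::{field,finite} set) - 1)"
  shows "(2 :: 'a) \<noteq> 0"
proof
  assume two: "(2 :: 'a) = 0"
  have "(\<Sum>x\<in>UNIV. x) = (\<Sum>x\<in>UNIV. x + 1 :: 'a)"
    by (rule sum.reindex_bij_witness[of _ "\<lambda>x. x + 1" "\<lambda>x. x - 1"]) auto
  hence "of_nat (card (UNIV :: 'a set)) = (0 :: 'a)"
    by (simp add: sum.distrib)
  moreover have "odd (card (UNIV :: 'a set))"
    using assms finite_UNIV_card_ge_0[where ?'a = 'a] by (cases "card (UNIV :: 'a set)") auto
  then obtain k where "card (UNIV :: 'a set) = 2 * k + 1"
    by (elim oddE)
  ultimately show False
    using two by simp
qed

section \<open>The number of solutions as affine zeros minus torus zeros\<close>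

theorem theorem1:
  fixes a :: "nat \<Rightarrow> 'a::{field,finite}" and b :: 'a
    and k :: nat and kk m :: "nat \<Rightarrow> nat" and n t :: nat
  defines "q \<equiv> card (UNIV :: 'a set)"
  defines "d \<equiv> (\<lambda>j. gcd (m j) (q - 1))"
  defines "k0 \<equiv> Gcd (insert k (insert (q - 1) (kk ` {1..n})))"
  defines "Nq \<equiv> card {x \<in> {1..n} \<rightarrow>\<^sub>E (UNIV :: 'a set).
                 (\<Sum>i\<in>{1..n}. a i * x i ^ m i) ^ k = b * (\<Prod>i\<in>{1..n}. x i ^ kk i)}"
  assumes n2: "n \<ge> 2"
    and a_nz: "\<forall>i\<in>{1..n}. a i \<noteq> 0" and b_nz: "b \<noteq> 0"
    and k_pos: "k > 0" and kk_pos: "\<forall>i\<in>{1..n}. kk i > 0" and m_pos: "\<forall>i\<in>{1..n}. m i > 0"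
    and t_le: "t \<le> n"
    and odd_d: "\<forall>j\<in>{1..t}. odd (d j)"
    and even_d: "\<forall>j\<in>{t+1..n}. even (d j)"
    and copr: "\<forall>i\<in>{1..n}. \<forall>j\<in>{1..n}. i \<noteq> j \<longrightarrow>
                 coprime (if i \<le> t then d i else d i div 2) (if j \<le> t then d j else d j div 2)"
    and b_not_pow: "\<not> (\<exists>y::'a. y ^ k0 = b)"
  shows "(t = 0 \<and> even n \<longrightarrow>
            real Nq = real q ^ (n - 1) - ((real q - 1) ^ n + real q - 1) / real q
              - (real q - 1) * (\<Sum>j\<in>{1..(n - 2) div 2}.
                   real_of_int (qchar ((-1::'a) ^ j)) * esym {1..n} (\<lambda>i. real_of_int (qchar (a i))) (2 * j)
                   * real q ^ (j - 1)))
       \<and> (t = n \<longrightarrow>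
            real Nq = real q ^ (n - 1) - ((real q - 1) ^ n + (-1) ^ n * (real q - 1)) / real q)
       \<and> (\<not> (t = 0 \<and> even n) \<and> t \<noteq> n \<longrightarrow>
            real Nq = real q ^ (n - 1) - ((real q - 1) ^ n + (-1) ^ n * (real q - 1)) / real q
              - (-1) ^ n * (real q - 1) * (\<Sum>j\<in>{1..(n - t) div 2}.
                   real_of_int (qchar ((-1::'a) ^ j)) * esym {t+1..n} (\<lambda>i. real_of_int (qchar (a i))) (2 * j)
                   * real q ^ (j - 1)))"
proof -
  define I where "I = {1..n}"
  define J where "J = {t+1..n}"
  define e :: "nat \<Rightarrow> nat" where "e = (\<lambda>i. if i \<in> J then 2 else 1)"
  define \<eta> where "\<eta> = (\<lambda>i. real_of_int (qchar (a i)))"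
  define Z where "Z = (\<lambda>(B :: 'a set) f. {x \<in> I \<rightarrow>\<^sub>E B. (\<Sum>i\<in>I. a i * x i ^ f i) = 0})"
  define \<sigma> where "\<sigma> = (\<lambda>r. \<Sum>j\<in>{1..r}. real_of_int (qchar ((-1::'a) ^ j)) * esym J \<eta> (2 * j) * real q ^ (j - 1))"
  have fin: "finite I" and J: "J \<subseteq> I" and ne: "I \<noteq> {}" and card_I: "card I = n" and card_J: "card J = n - t"
    using n2 by (auto simp: I_def J_def)
  have notin_J: "i \<notin> J \<longleftrightarrow> i \<le> t" if "i \<in> I" for i
    using that by (auto simp: I_def J_def)
  have two: "(2 :: 'a) \<noteq> 0" if "J \<noteq> {}"
  proof -
    \<comment> \<open>A nonempty \<open>J\<close> contains \<open>n\<close>, and the even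
      \<open>d n\<close> divides \<open>q - 1\<close>.\<close>
    have "even (d n)"
      using that even_d by (auto simp: J_def)
    hence "even (q - 1)"
      unfolding d_def by (meson dvd_trans gcd_dvd2)
    thus ?thesis
      unfolding q_def by (rule two_neq_zero_if_even_card_minus_one)
  qed
  have finZ: "finite (Z B f)" for B f
    unfolding Z_def using finite_PiE[OF fin, of "\<lambda>_. B"] by simp

  have "{x \<in> I \<rightarrow>\<^sub>E (UNIV :: 'a set). (\<Sum>i\<in>I. a i * x i ^ m i) ^ k = b * (\<Prod>i\<in>I. x i ^ kk i)} =
      Z UNIV m - Z (UNIV - {0}) m"
  proof (intro set_eqI)
    fix x
    let ?L = "\<Sum>i\<in>I. a i * x i ^ m i"
    have "?L ^ k = b * (\<Prod>i\<in>I. x i ^ kk i) \<longleftrightarrow> ?L = 0 \<and> (\<exists>i\<in>I. x i = 0)"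
    proof (cases "\<exists>i\<in>I. x i = 0")
      case True
      then obtain i where "i \<in> I" "x i = 0" by blast
      moreover from this have "x i ^ kk i = 0"
        using kk_pos by (simp add: I_def zero_power)
      ultimately have "(\<Prod>i\<in>I. x i ^ kk i) = 0"
        using fin by (meson prod_zero)
      thus ?thesis
        using True k_pos by simp
    next
      case False
      \<comment> \<open>As \<open>k0\<close> divides \<open>k\<close> and every \<open>kk i\<close>,
        a solution without zero coordinates would make \<open>b\<close> a quotient of
        \<open>k0\<close>-th powers.\<close>
      have "?L ^ k \<noteq> b * (\<Prod>i\<in>I. x i ^ kk i)"
      proof
        assume eq: "?L ^ k = b * (\<Prod>i\<in>I. x i ^ kk i)"
        have "k0 dvd k"
          unfolding k0_def by (rule Gcd_dvd) simp
        hence Lk: "?L ^ k = (?L ^ (k div k0)) ^ k0"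
          by (simp flip: power_mult)
        have "x i ^ kk i = (x i ^ (kk i div k0)) ^ k0" if "i \<in> I" for i
        proof -
          have "k0 dvd kk i"
            unfolding k0_def by (rule Gcd_dvd) (use that in \<open>simp add: I_def\<close>)
          thus ?thesis
            by (simp flip: power_mult)
        qed
        hence prod: "(\<Prod>i\<in>I. x i ^ kk i) = (\<Prod>i\<in>I. x i ^ (kk i div k0)) ^ k0"
          by (simp flip: prod_power_distrib)
        have "(\<Prod>i\<in>I. x i ^ kk i) \<noteq> 0"
          using False fin by auto
        hence "b = ?L ^ k / (\<Prod>i\<in>I. x i ^ kk i)"
          by (simp add: eq)
        also have "\<dots> = (?L ^ (k div k0) / (\<Prod>i\<in>I. x i ^ (kk i div k0))) ^ k0"
          unfolding Lk prod by (rule power_divide[symmetric])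
        finally show False
          using b_not_pow by metis
      qed
      thus ?thesis
        using False by simp
    qed
    thus "x \<in> {x \<in> I \<rightarrow>\<^sub>E UNIV. (\<Sum>i\<in>I. a i * x i ^ m i) ^ k = b * (\<Prod>i\<in>I. x i ^ kk i)} \<longleftrightarrow>
        x \<in> Z UNIV m - Z (UNIV - {0}) m"
      by (auto simp: Z_def PiE_iff)
  qed
  moreover have "Z (UNIV - {0}) m \<subseteq> Z UNIV m"
    by (auto simp: Z_def PiE_iff)
  ultimately have Nq: "real Nq = real (card (Z UNIV m)) - real (card (Z (UNIV - {0}) m))"
    unfolding Nq_def I_def[symmetric]
    by (simp add: card_Diff_subset finZ card_mono of_nat_diff)

  \<comment> \<open>All subsets \<open>S\<close> are treated, not only \<open>I\<close>, because the
    affine count is split by supports.\<close>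
  have torus: "card {x \<in> S \<rightarrow>\<^sub>E (UNIV - {0}). (\<Sum>i\<in>S. a i * x i ^ m i) = 0} =
      card {x \<in> S \<rightarrow>\<^sub>E (UNIV - {0}). (\<Sum>i\<in>S. a i * x i ^ e i) = 0}" if S: "S \<subseteq> I" for S
  proof (rule card_torus_diagonal_eq)
    show "finite S"
      using S fin by (rule finite_subset)
    fix y :: "nat \<Rightarrow> 'a"
    assume y: "\<And>i. i \<in> S \<Longrightarrow> y i \<noteq> 0"
    show "(\<exists>\<mu>. \<mu> \<noteq> 0 \<and> (\<forall>i\<in>S. \<exists>z. z \<noteq> 0 \<and> z ^ m i = \<mu> * y i)) \<longleftrightarrow>
          (\<exists>\<mu>. \<mu> \<noteq> 0 \<and> (\<forall>i\<in>S. \<exists>z. z \<noteq> 0 \<and> z ^ e i = \<mu> * y i))"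
      unfolding e_def
    proof (rule twisted_power_image_iff[OF \<open>finite S\<close> y])
      show "odd (gcd (m i) (card (UNIV :: 'a set) - 1))" if "i \<in> S - J" for i
      proof -
        have "i \<in> {1..t}" using that S by (auto simp: I_def J_def)
        thus ?thesis using odd_d unfolding d_def q_def by blast
      qed
      show "even (gcd (m i) (card (UNIV :: 'a set) - 1))" if "i \<in> S \<inter> J" for i
      proof -
        have "i \<in> {t+1..n}" using that by (auto simp: J_def)
        thus ?thesis using even_d unfolding d_def q_def by blast
      qed
      fix i j assume ij: "i \<in> S" "j \<in> S" "i \<noteq> j"
      hence "coprime (if i \<le> t then d i else d i div 2) (if j \<le> t then d j else d j div 2)"
        using copr S by (simp add: I_def subset_iff)
      moreover have "(if l \<le> t then d l else d l div 2) = (if l \<in> J then d l div 2 else d l)" if "l \<in> S" for l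
        using notin_J[of l] S that by auto
      ultimately have "coprime (if i \<in> J then d i div 2 else d i) (if j \<in> J then d j div 2 else d j)"
        using ij by simp
      thus "coprime (if i \<in> J then gcd (m i) (card (UNIV :: 'a set) - 1) div 2 else gcd (m i) (card (UNIV :: 'a set) - 1))
          (if j \<in> J then gcd (m j) (card (UNIV :: 'a set) - 1) div 2 else gcd (m j) (card (UNIV :: 'a set) - 1))"
        unfolding d_def q_def .
    qed
  qed
  have a_nz': "\<And>i. i \<in> I \<Longrightarrow> a i \<noteq> 0"
    using a_nz by (simp add: I_def)
  have "card (Z UNIV m) = card (Z UNIV e)"
    unfolding Z_def using m_pos torus
    by (intro card_affine_diagonal_eq[OF fin]) (auto simp: I_def e_def)
  hence affine_count: "real (card (Z UNIV m)) = real q ^ (n - 1) +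
      (if J = I then (\<Prod>i\<in>I. \<eta> i) * qchar_conv n (0 :: 'a) else 0)"
    using card_diagonal_affine_zeros[OF fin ne J a_nz' two] by (simp add: Z_def e_def card_I q_def \<eta>_def)
  have torus_count: "real (card (Z (UNIV - {0}) m)) =
      ((real q - 1) ^ n + (-1) ^ n * (real q - 1)) / real q + (-1) ^ n * (real q - 1) * \<sigma> ((n - t) div 2)"
    using card_diagonal_torus_zeros[OF fin J a_nz' two] torus[OF subset_refl]
    by (simp add: Z_def e_def card_I card_J q_def \<eta>_def \<sigma>_def)

  consider "t = 0" "even n" | "t = n" | "\<not> (t = 0 \<and> even n)" "t \<noteq> n"
    by blast
  thus ?thesis
  proof cases
    case 1
    hence JI: "J = I" by (simp add: I_def J_def)
    obtain h where h: "n = 2 * h" using 1 by (elim evenE)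
    have "h > 0" using h n2 by simp
    \<comment> \<open>The extra affine term is exactly the summand \<open>j = h\<close> of the torus
      sum. The two cancel, so the sum ends at \<open>h - 1\<close>, which is
      \<open>(n - 2) div 2\<close>.\<close>
    have "(\<Prod>i\<in>I. \<eta> i) = esym J \<eta> (2 * h)"
      using esym_card[OF fin, of \<eta>] by (simp add: JI card_I h)
    hence "(\<Prod>i\<in>I. \<eta> i) * qchar_conv n (0 :: 'a) =
        (real q - 1) * (real_of_int (qchar ((-1::'a) ^ h)) * esym J \<eta> (2 * h) * real q ^ (h - 1))"
      using qchar_conv_even_0[OF \<open>h > 0\<close>, where ?'a = 'a] by (simp add: h q_def)
    moreover have "\<sigma> h = \<sigma> (h - 1) + real_of_int (qchar ((-1::'a) ^ h)) * esym J \<eta> (2 * h) * real q ^ (h - 1)"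
      using \<open>h > 0\<close> by (cases h) (simp_all add: \<sigma>_def)
    ultimately have "real Nq = real q ^ (n - 1) - ((real q - 1) ^ n + real q - 1) / real q
        - (real q - 1) * \<sigma> (h - 1)"
      unfolding Nq affine_count torus_count using JI 1 h by (simp add: algebra_simps)
    moreover have "(n - 2) div 2 = h - 1" "{1..n} = J"
      using h JI by (simp_all add: I_def)
    ultimately show ?thesis
      using 1 n2 unfolding \<sigma>_def \<eta>_def by simp
  next
    case 2
    hence "J \<noteq> I" using ne by (simp add: J_def)
    thus ?thesis
      using 2 n2 unfolding Nq affine_count torus_count by (simp add: \<sigma>_def)
  next
    case 3
    \<comment> \<open>No affine correction: \<open>J = I\<close> would force \<open>t = 0\<close>,
      hence odd \<open>n\<close>, and odd convolution powers vanish at 0.\<close>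
    have "(if J = I then (\<Prod>i\<in>I. \<eta> i) * qchar_conv n (0 :: 'a) else 0) = 0"
    proof (cases "t = 0")
      case True
      thus ?thesis using 3 by (simp add: qchar_conv_odd_0)
    next
      case False
      hence "1 \<notin> J" "1 \<in> I" using n2 by (auto simp: I_def J_def)
      thus ?thesis by auto
    qed
    hence "real Nq = real q ^ (n - 1) - ((real q - 1) ^ n + (-1) ^ n * (real q - 1)) / real q
        - (-1) ^ n * (real q - 1) * \<sigma> ((n - t) div 2)"
      unfolding Nq affine_count torus_count by linarith
    thus ?thesis
      using 3 unfolding \<sigma>_def \<eta>_def J_def by blast
  qed
qed

end
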